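(* Let $\mathscr{H}$ be a complex Hilbert space and let $A,B,X\in\mathbb{B}(\mathscr{H})$ be such that $A$ and $B$ are positive. Then $$w^{r}(A^\alpha X B^{1-\alpha})\leq \|X\|^{r}\,\big\|\alpha A^r+(1-\alpha)B^r\big\|$$ for all $r\geq 2$ and $0\leq\alpha\leq 1$.
   Context: $\mathbb{B}(\mathscr{H})$ denotes the $C^*$-algebra of all bounded linear operators on the complex Hilbert space $\mathscr{H}$, and $\|\cdot\|$ is the operator norm. An operator $A\in\mathbb{B}(\mathscr{H})$ is called positive if $\langle Ax,x\rangle\geq 0$ for all $x\in\mathscr{H}$ (so positive means positive semidefinite; invertibility is not required). The numerical radius of $A\in\mathbb{B}(\mathscr{H})$ is $w(A)=\sup\{|\langle Ax,x\rangle| : x\in\mathscr{H},\ \|x\|=1\}$, and $w^s(A)$ means $(w(A))^s$. Real powers of positive operators are defined by continuous functional calculus, with $A^0=I$. *)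

theory Defs
  imports "HOL-Analysis.Analysis" "HOL-Computational_Algebra.Polynomial"
begin

class scaleC =
  fixes scaleC :: "complex \<Rightarrow> 'a \<Rightarrow> 'a" (infixr "*\<^sub>C" 75)

text \<open>Complex Hilbert spaces; the inner product is linear in its first argument, and
  completeness is inherited from \<^class>\<open>banach\<close>.\<close>

class chilbert_space = banach + scaleC +
  fixes cinner :: "'a \<Rightarrow> 'a \<Rightarrow> complex"
  assumes scaleC_add_right: "a *\<^sub>C (x + y) = a *\<^sub>C x + a *\<^sub>C y"
    and scaleC_add_left: "(a + b) *\<^sub>C x = a *\<^sub>C x + b *\<^sub>C x"
    and scaleC_scaleC: "a *\<^sub>C b *\<^sub>C x = (a * b) *\<^sub>C x"
    and scaleC_one: "1 *\<^sub>C x = x"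
    and scaleR_scaleC: "t *\<^sub>R x = complex_of_real t *\<^sub>C x"
    and cinner_commute: "cinner x y = cnj (cinner y x)"
    and cinner_add_left: "cinner (x + y) z = cinner x z + cinner y z"
    and cinner_scaleC_left: "cinner (a *\<^sub>C x) y = a * cinner x y"
    and cinner_self_nonneg: "cinner x x \<in> \<real>\<^sub>\<ge>\<^sub>0"
    and norm_eq_sqrt_cinner: "norm x = sqrt (Re (cinner x x))"

text \<open>The library type of bounded linear maps only asks for real linearity, so the algebra of
  bounded operators of a complex Hilbert space is the subset of the complex-linear ones.
  It inherits its norm, which is the operator norm.\<close>

definition bounded_operators :: "('a::chilbert_space \<Rightarrow>\<^sub>L 'a) set" where
  "bounded_operators = {A :: 'a \<Rightarrow>\<^sub>L 'a. \<forall>c x. A (c *\<^sub>C x) = c *\<^sub>C A x}"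

definition positive_op :: "('a::chilbert_space \<Rightarrow>\<^sub>L 'a) \<Rightarrow> bool" where
  "positive_op A \<longleftrightarrow> A \<in> bounded_operators \<and> (\<forall>x. cinner (A x) x \<in> \<real>\<^sub>\<ge>\<^sub>0)"

text \<open>All the values are nonnegative. Inserting 0 only matters on the zero space, which has no
  unit vectors and where the supremum of the empty set has to be read as 0.\<close>

definition numerical_radius :: "('a::chilbert_space \<Rightarrow>\<^sub>L 'a) \<Rightarrow> real" where
  "numerical_radius A = Sup (insert 0 {cmod (cinner (A x) x) | x. norm x = 1})"

definition op_spectrum :: "('a::chilbert_space \<Rightarrow>\<^sub>L 'a) \<Rightarrow> complex set" where
  "op_spectrum A = {z. \<not> (\<exists>S \<in> bounded_operators.
      (\<forall>x. S (A x - z *\<^sub>C x) = x) \<and> (\<forall>x. A (S x) - z *\<^sub>C S x = x))}"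

definition op_poly :: "real poly \<Rightarrow> ('a::chilbert_space \<Rightarrow>\<^sub>L 'a) \<Rightarrow> ('a \<Rightarrow>\<^sub>L 'a)" where
  "op_poly p A = (\<Sum>i\<le>degree p. coeff p i *\<^sub>R (((o\<^sub>L) A ^^ i) id_blinfun))"

text \<open>Continuous functional calculus of a self-adjoint operator \<open>A\<close> for a real function \<open>f\<close> that
  is continuous on the spectrum: the norm limit of \<open>p\<^sub>n(A)\<close> for any real polynomials \<open>p\<^sub>n\<close> that
  converge to \<open>f\<close> uniformly on the spectrum. Such an operator has a real spectrum, so nothing is
  lost by looking at real points only.\<close>

definition cfc :: "(real \<Rightarrow> real) \<Rightarrow> ('a::chilbert_space \<Rightarrow>\<^sub>L 'a) \<Rightarrow> ('a \<Rightarrow>\<^sub>L 'a)" where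
  "cfc f A = (THE T. \<exists>p :: nat \<Rightarrow> real poly.
      uniform_limit {t. complex_of_real t \<in> op_spectrum A} (\<lambda>n t. poly (p n) t) f sequentially \<and>
      (\<lambda>n. op_poly (p n) A) \<longlonglongrightarrow> T)"

text \<open>The case distinction is needed since \<open>0 powr 0 = 0\<close> in the library, whereas the zeroth
  power of every positive operator is the identity.\<close>

definition op_powr :: "('a::chilbert_space \<Rightarrow>\<^sub>L 'a) \<Rightarrow> real \<Rightarrow> ('a \<Rightarrow>\<^sub>L 'a)" where
  "op_powr A s = cfc (\<lambda>t. if s = 0 then 1 else t powr s) A"

end

theory Submission
  imports Defs "HOL-Computational_Algebra.Fundamental_Theorem_Algebra"
begin

text \<open>For a unit vector \<open>x\<close>, moving \<open>A\<^sup>\<alpha>\<close> to the other side of the inner product and the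
  Cauchy-Schwarz inequality give
  \<open>\<bar>\<langle>A\<^sup>\<alpha> X B\<^bsup>1-\<alpha>\<^esup> x, x\<rangle>\<bar>\<^sup>r \<le> \<parallel>X\<parallel>\<^sup>r \<parallel>A\<^sup>\<alpha> x\<parallel>\<^sup>r \<parallel>B\<^bsup>1-\<alpha>\<^esup> x\<parallel>\<^sup>r\<close>. The Hoelder-McCarthy inequality
  (\<open>norm_op_powr_le\<close>) bounds \<open>\<parallel>A\<^sup>\<alpha> x\<parallel>\<^sup>r\<close> by \<open>\<langle>A\<^sup>r x, x\<rangle>\<^sup>\<alpha>\<close>; this is where \<open>r \<ge> 2\<close> enters, through
  \<open>2 \<alpha> \<le> r\<close> and \<open>2 (1 - \<alpha>) \<le> r\<close>. The weighted inequality between the arithmetic and the geometric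
  mean turns the product \<open>\<langle>A\<^sup>r x, x\<rangle>\<^sup>\<alpha> \<langle>B\<^sup>r x, x\<rangle>\<^bsup>1-\<alpha>\<^esup>\<close> into the form of
  \<open>\<alpha> A\<^sup>r + (1 - \<alpha>) B\<^sup>r\<close> at \<open>x\<close>, which is at most the norm of that operator.

  The operator inequality behind Hoelder-McCarthy is the scalar Young inequality, transported to
  \<open>A\<close> by the functional calculus (\<open>cfc_form_inequality\<close>). This rests on one fact: a real
  polynomial that is nonnegative on the spectrum of a positive operator \<open>A\<close> gives an operator
  \<open>p(A)\<close> with nonnegative form (\<open>op_poly_nonneg\<close>). It also bounds \<open>\<parallel>p(A)\<parallel>\<close> by the supremum of
  \<open>\<bar>p\<bar>\<close> on the spectrum, which makes the functional calculus well defined.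

  The fact has an elementary proof. The largest lower bound \<open>m\<close> of the form of \<open>p(A)\<close> is an
  approximate eigenvalue of \<open>p(A)\<close>. Splitting \<open>p - m\<close> into complex linear factors shows that
  some root \<open>\<mu>\<close> of it is an approximate eigenvalue of \<open>A\<close>. Then \<open>\<mu>\<close> is real and lies in the
  spectrum, so \<open>m = p(\<mu>)\<close> is nonnegative. The real points of the spectrum lie in \<open>[0, \<parallel>A\<parallel>]\<close> by the
  Lax-Milgram theorem, so the Weierstrass approximation theorem on this interval supplies the
  approximating polynomials.\<close>

section \<open>Complex Hilbert spaces\<close>

lemma cinner_add_right: "cinner x (y + z) = cinner x y + cinner x z"
  by (metis cinner_add_left cinner_commute complex_cnj_add)

lemma cinner_scaleC_right: "cinner x (a *\<^sub>C y) = cnj a * cinner x y"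
  by (metis cinner_scaleC_left cinner_commute complex_cnj_mult)

lemma cinner_scaleR_left: "cinner (t *\<^sub>R x) y = complex_of_real t * cinner x y"
  by (simp add: scaleR_scaleC cinner_scaleC_left)

lemma cinner_scaleR_right: "cinner x (t *\<^sub>R y) = complex_of_real t * cinner x y"
  by (simp add: scaleR_scaleC cinner_scaleC_right)

lemma cinner_minus_left: "cinner (- x) y = - cinner x y"
  using cinner_scaleR_left[of "-1" x y] by simp

lemma cinner_minus_right: "cinner x (- y) = - cinner x y"
  using cinner_scaleR_right[of x "-1" y] by simp

lemma cinner_diff_left: "cinner (x - y) z = cinner x z - cinner y z"
  using cinner_add_left[of x "-y" z] by (simp add: cinner_minus_left)

lemma cinner_diff_right: "cinner x (y - z) = cinner x y - cinner x z"
  using cinner_add_right[of x y "-z"] by (simp add: cinner_minus_right)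

lemmas cinner_simps = cinner_add_left cinner_add_right cinner_diff_left cinner_diff_right
  cinner_scaleC_left cinner_scaleC_right cinner_scaleR_left cinner_scaleR_right
  cinner_minus_left cinner_minus_right

lemma cinner_zero_left [simp]: "cinner 0 x = 0"
  using cinner_scaleR_left[of 0 0 x] by simp

lemma cinner_zero_right [simp]: "cinner x 0 = 0"
  using cinner_scaleR_right[of x 0 0] by simp

lemma cinner_self: "cinner x x = complex_of_real ((norm x)\<^sup>2)"
  using cinner_self_nonneg[of x]
  by (simp add: norm_eq_sqrt_cinner complex_nonneg_Reals_iff complex_eq_iff)

lemma Re_cinner_commute: "Re (cinner y x) = Re (cinner x y)"
  by (metis cinner_commute complex_cnj cnj.sel(1))

lemma norm_scaleC: "norm (a *\<^sub>C (x::'a::chilbert_space)) = cmod a * norm x"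
proof -
  have "cinner (a *\<^sub>C x) (a *\<^sub>C x) = (a * cnj a) * cinner x x"
    by (simp add: cinner_scaleC_left cinner_scaleC_right)
  also have "\<dots> = complex_of_real ((cmod a)\<^sup>2 * (norm x)\<^sup>2)"
    by (simp only: cinner_self complex_norm_square[symmetric] of_real_mult)
  finally have "cinner (a *\<^sub>C x) (a *\<^sub>C x) = complex_of_real ((cmod a)\<^sup>2 * (norm x)\<^sup>2)" .
  then have "(norm (a *\<^sub>C x))\<^sup>2 = (cmod a * norm x)\<^sup>2"
    by (metis cinner_self of_real_eq_iff power_mult_distrib)
  then show ?thesis
    by (simp add: power2_eq_iff_nonneg)
qed

lemma scaleC_zero_right [simp]: "a *\<^sub>C (0::'a::chilbert_space) = 0"
  using norm_scaleC[of a "0::'a"] by simp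

lemma scaleC_zero_left [simp]: "0 *\<^sub>C (x::'a::chilbert_space) = 0"
  using norm_scaleC[of 0 x] by simp

lemma scaleC_minus_left: "(- a) *\<^sub>C (x::'a::chilbert_space) = - (a *\<^sub>C x)"
  by (metis add.right_inverse add_eq_0_iff scaleC_add_left scaleC_zero_left)

lemma norm_diff_sq:
  "(norm (x - y))\<^sup>2 = (norm x)\<^sup>2 - 2 * Re (cinner x y) + (norm (y::'a::chilbert_space))\<^sup>2"
proof -
  have "complex_of_real ((norm (x - y))\<^sup>2)
      = of_real ((norm x)\<^sup>2) - (cinner x y + cinner y x) + of_real ((norm y)\<^sup>2)"
    unfolding cinner_self[symmetric] by (simp add: cinner_simps)
  then have "Re (complex_of_real ((norm (x - y))\<^sup>2))
      = Re (of_real ((norm x)\<^sup>2) - (cinner x y + cinner y x) + of_real ((norm y)\<^sup>2))"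
    by simp
  then show ?thesis
    by (simp add: Re_cinner_commute[of y x] del: of_real_power)
qed

lemma Re_cinner_le: "Re (cinner x y) \<le> norm x * norm (y::'a::chilbert_space)"
proof (cases "x = 0 \<or> y = 0")
  case False
  then have pos: "norm x > 0" "norm y > 0" by auto
  have "0 \<le> (norm (norm y *\<^sub>R x - norm x *\<^sub>R y))\<^sup>2" by simp
  also have "\<dots> = 2 * (norm x * norm y) * (norm x * norm y - Re (cinner x y))"
    unfolding norm_diff_sq by (simp add: cinner_simps power2_eq_square algebra_simps)
  finally show ?thesis
    using mult_pos_pos[OF pos] by (simp add: zero_le_mult_iff)
qed auto

text \<open>Rotating \<open>x\<close> by a unimodular scalar makes the inner product real and nonnegative, which
  reduces the complex inequality to the real one.\<close>

lemma Cauchy_Schwarz_cinner: "cmod (cinner x y) \<le> norm x * norm (y::'a::chilbert_space)"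
proof (cases "cinner x y = 0")
  case False
  define u where "u = cnj (cinner x y) / cmod (cinner x y)"
  have "cmod u = 1" using False by (simp add: u_def norm_divide)
  moreover have "cinner (u *\<^sub>C x) y = complex_of_real (cmod (cinner x y))"
    using False by (simp add: u_def cinner_simps field_simps complex_norm_square[symmetric] power2_eq_square)
  ultimately show ?thesis
    using Re_cinner_le[of "u *\<^sub>C x" y] by (simp add: norm_scaleC)
qed auto

section \<open>Self-adjoint and positive operators\<close>

definition selfadjoint :: "('a::chilbert_space \<Rightarrow>\<^sub>L 'a) \<Rightarrow> bool" where
  "selfadjoint A \<longleftrightarrow> (\<forall>x y. cinner (A x) y = cinner x (A y))"

text \<open>Polarization: the quadratic form of \<open>A\<close> is real at \<open>x + y\<close> and at \<open>x + \<i> y\<close>.\<close>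

lemma positive_op_selfadjoint:
  assumes "positive_op A"
  shows "selfadjoint A"
  unfolding selfadjoint_def
proof (intro allI)
  fix x y
  have im: "Im (cinner (A z) z) = 0" for z
    using assms by (auto simp: positive_op_def complex_nonneg_Reals_iff)
  have sc: "A (\<i> *\<^sub>C y) = \<i> *\<^sub>C A y"
    using assms by (auto simp: positive_op_def bounded_operators_def)
  have "Im (cinner (A x) y) + Im (cinner (A y) x) = 0"
    using im[of "x + y"] im[of x] im[of y] by (simp add: blinfun.add_right cinner_simps)
  moreover have "Re (cinner (A y) x) = Re (cinner (A x) y)"
    using im[of "x + \<i> *\<^sub>C y"] im[of x] im[of y]
    by (simp add: blinfun.add_right sc cinner_simps)
  ultimately have "cinner (A x) y = cnj (cinner (A y) x)"
    by (simp add: complex_eq_iff)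
  then show "cinner (A x) y = cinner x (A y)"
    by (metis cinner_commute)
qed

lemma Im_cinner_selfadjoint:
  assumes "selfadjoint A"
  shows "Im (cinner (A x) x) = 0"
  by (metis assms cinner_commute complex_is_Real_iff Reals_cnj_iff selfadjoint_def)

text \<open>Where the quadratic form of a positive operator is small, the operator itself is small.
  The form is evaluated at \<open>x - S x / K\<close>.\<close>

lemma norm_sq_le_form:
  fixes S :: "'a::chilbert_space \<Rightarrow>\<^sub>L 'a"
  assumes sa: "selfadjoint S" and pos: "\<And>x. 0 \<le> Re (cinner (S x) x)"
    and K: "norm S \<le> K" "0 < K"
  shows "(norm (S x))\<^sup>2 \<le> K * Re (cinner (S x) x)"
proof -
  define y where "y = S x"
  have "Re (cinner (S y) y) \<le> norm (S y) * norm y"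
    by (rule Re_cinner_le)
  also have "\<dots> \<le> (K * norm y) * norm y"
    by (meson K(1) mult_right_mono norm_blinfun norm_ge_zero order_trans)
  finally have SS: "Re (cinner (S y) y) \<le> K * (norm y)\<^sup>2"
    by (simp add: power2_eq_square mult.assoc)
  have "cinner (S y) x = cinner y y" "cinner (S x) y = cinner y y"
    using sa by (auto simp: y_def selfadjoint_def)
  then have "Re (cinner (S (x - (1/K) *\<^sub>R y)) (x - (1/K) *\<^sub>R y))
      = Re (cinner (S x) x) - 2 / K * (norm y)\<^sup>2 + Re (cinner (S y) y) / K\<^sup>2"
    by (simp add: blinfun.diff_right blinfun.scaleR_right cinner_simps cinner_self
        power2_eq_square algebra_simps)
  also have "\<dots> \<le> Re (cinner (S x) x) - 2 / K * (norm y)\<^sup>2 + K * (norm y)\<^sup>2 / K\<^sup>2"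
    using SS K by (intro add_left_mono divide_right_mono) auto
  also have "\<dots> = Re (cinner (S x) x) - (norm y)\<^sup>2 / K"
    using K by (simp add: power2_eq_square field_simps)
  finally have "0 \<le> Re (cinner (S x) x) - (norm y)\<^sup>2 / K"
    using pos order_trans by blast
  then show ?thesis
    using K by (simp add: y_def field_simps)
qed

section \<open>The spectrum of a positive operator\<close>

text \<open>The surjectivity half of the Lax-Milgram theorem. For large \<open>c\<close> the map
  \<open>x \<mapsto> x - (S x - y) / c\<close> is a contraction, and its fixed point solves \<open>S x = y\<close>.\<close>

lemma coercive_solvable:
  fixes S :: "'a::chilbert_space \<Rightarrow>\<^sub>L 'a"
  assumes d: "0 < d" and coer: "\<And>x. d * (norm x)\<^sup>2 \<le> Re (cinner (S x) x)"
  shows "\<exists>x. S x = y"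
proof -
  define L where "L = norm S + d"
  have L: "0 < L" "d \<le> L" "norm S \<le> L" using d by (auto simp: L_def add_nonneg_pos)
  \<comment> \<open>This \<open>c\<close> minimizes the bound \<open>1 - 2 d / c + L\<^sup>2 / c\<^sup>2\<close> for the squared Lipschitz constant.\<close>
  define c where "c = L\<^sup>2 / d"
  define k where "k = sqrt (1 - d\<^sup>2 / L\<^sup>2)"
  have c: "0 < c" using L d by (simp add: c_def)
  have dL: "d\<^sup>2 / L\<^sup>2 \<le> 1" "0 < d\<^sup>2 / L\<^sup>2" using L d by (auto simp: power_mono)
  have k: "0 \<le> k" "k < 1" using dL by (auto simp: k_def)
  have contr: "norm (x - (1/c) *\<^sub>R S x) \<le> k * norm x" for x
  proof -
    have "(norm (S x))\<^sup>2 \<le> (L * norm x)\<^sup>2"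
      using L by (intro power_mono order_trans[OF norm_blinfun] mult_right_mono) auto
    then have 1: "(norm (S x))\<^sup>2 / c\<^sup>2 \<le> (L * norm x)\<^sup>2 / c\<^sup>2"
      by (rule divide_right_mono) auto
    have 2: "2 / c * (d * (norm x)\<^sup>2) \<le> 2 / c * Re (cinner (S x) x)"
      using coer[of x] c by (intro mult_left_mono) auto
    have "(norm (x - (1/c) *\<^sub>R S x))\<^sup>2
        = (norm x)\<^sup>2 - 2 / c * Re (cinner (S x) x) + (norm (S x))\<^sup>2 / c\<^sup>2"
      using c Re_cinner_commute[of x "S x"]
      by (simp add: norm_diff_sq cinner_simps power_divide)
    also have "\<dots> \<le> (norm x)\<^sup>2 - 2 / c * (d * (norm x)\<^sup>2) + (L * norm x)\<^sup>2 / c\<^sup>2"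
      using 1 2 by linarith
    also have "\<dots> = (1 - d\<^sup>2 / L\<^sup>2) * (norm x)\<^sup>2"
      using L d by (simp add: c_def field_simps power2_eq_square)
    also have "\<dots> = (k * norm x)\<^sup>2"
      using dL by (simp add: k_def power_mult_distrib)
    finally show ?thesis
      using k by (meson mult_nonneg_nonneg norm_ge_zero power2_le_imp_le)
  qed
  have "\<exists>!x. x - (1/c) *\<^sub>R (S x - y) = x"
  proof (rule banach_fix_type[OF k], intro allI)
    fix x z
    have "(x - (1/c) *\<^sub>R (S x - y)) - (z - (1/c) *\<^sub>R (S z - y)) = (x - z) - (1/c) *\<^sub>R S (x - z)"
      by (simp add: blinfun.diff_right algebra_simps)
    then show "dist (x - (1/c) *\<^sub>R (S x - y)) (z - (1/c) *\<^sub>R (S z - y)) \<le> k * dist x z"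
      using contr[of "x - z"] by (simp only: dist_norm)
  qed
  then obtain x where "x - (1/c) *\<^sub>R (S x - y) = x" by auto
  then show ?thesis using c by auto
qed

lemma coercive_invertible:
  fixes S :: "'a::chilbert_space \<Rightarrow>\<^sub>L 'a"
  assumes d: "0 < d" and coer: "\<And>x. d * (norm x)\<^sup>2 \<le> Re (cinner (S x) x)"
    and lin: "S \<in> bounded_operators"
  shows "\<exists>R \<in> bounded_operators. (\<forall>x. R (S x) = x) \<and> (\<forall>x. S (R x) = x)"
proof -
  have below: "d * norm x \<le> norm (S x)" for x
  proof (cases "x = 0")
    case False
    have "d * (norm x)\<^sup>2 \<le> norm (S x) * norm x"
      using coer[of x] Re_cinner_le[of "S x" x] by linarith
    then show ?thesis using False by (simp add: power2_eq_square)
  qed simp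
  have inj: "x = z" if "S x = S z" for x z
    using below[of "x - z"] that d by (simp add: blinfun.diff_right mult_le_0_iff)
  obtain g where g: "\<And>y. S (g y) = y"
    using coercive_solvable[OF d coer] by metis
  have gS: "g (S x) = x" for x
    by (rule inj) (rule g)
  have "bounded_linear g"
  proof (rule bounded_linear_intro[where K = "1 / d"])
    show "g (x + y) = g x + g y" for x y
      by (rule inj) (simp add: blinfun.add_right g)
    show "g (t *\<^sub>R x) = t *\<^sub>R g x" for t x
      by (rule inj) (simp add: blinfun.scaleR_right g)
    show "norm (g x) \<le> norm x * (1 / d)" for x
      using below[of "g x"] d by (simp add: g field_simps)
  qed
  then have app: "blinfun_apply (Blinfun g) = g"
    by (rule bounded_linear_Blinfun_apply)
  have "g (a *\<^sub>C x) = a *\<^sub>C g x" for a x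
    by (rule inj) (use lin in \<open>simp add: bounded_operators_def g\<close>)
  then show ?thesis
    by (intro bexI[of _ "Blinfun g"]) (auto simp: app g gS bounded_operators_def)
qed

lemma positive_op_real_spectrum:
  fixes A :: "'a::chilbert_space \<Rightarrow>\<^sub>L 'a"
  assumes A: "positive_op A" and t: "complex_of_real t \<in> op_spectrum A"
  shows "0 \<le> t \<and> t \<le> norm A"
proof -
  have A_lin: "A (c *\<^sub>C x) = c *\<^sub>C A x" for c x
    using A by (auto simp: positive_op_def bounded_operators_def)
  \<comment> \<open>Depending on the side of the interval on which \<open>t\<close> lies, \<open>A - t\<close> or \<open>t - A\<close> is coercive.\<close>
  have notcoer: False
    if s: "s = 1 \<or> s = -1" and d: "0 < d"
      and coer: "\<And>x. d * (norm x)\<^sup>2 \<le> s * (Re (cinner (A x) x) - t * (norm x)\<^sup>2)" for s d :: real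
  proof -
    define S where "S = s *\<^sub>R (A - t *\<^sub>R id_blinfun)"
    have S: "S x = s *\<^sub>R (A x - of_real t *\<^sub>C x)" for x
      by (simp add: S_def blinfun.bilinear_simps scaleR_scaleC)
    have "S \<in> bounded_operators"
      by (simp add: bounded_operators_def S A_lin scaleR_scaleC scaleC_scaleC mult_ac
          scaleC_add_right scaleC_minus_left[symmetric] diff_conv_add_uminus
          del: add_uminus_conv_diff)
    moreover have "d * (norm x)\<^sup>2 \<le> Re (cinner (S x) x)" for x
      using coer[of x] by (simp add: S cinner_simps cinner_self)
    ultimately obtain R where R: "R \<in> bounded_operators" "\<And>x. R (S x) = x" "\<And>x. S (R x) = x"
      using coercive_invertible[OF d] by blast
    have "s *\<^sub>R R \<in> bounded_operators"
      using R(1) by (auto simp: bounded_operators_def blinfun.scaleR_left scaleR_scaleC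
          scaleC_scaleC mult.commute)
    moreover have "(s *\<^sub>R R) (A x - of_real t *\<^sub>C x) = x" for x
      using R(2)[of x]
      by (simp add: S blinfun.scaleR_left blinfun.scaleR_right)
    moreover have "A ((s *\<^sub>R R) x) - of_real t *\<^sub>C (s *\<^sub>R R) x = x" for x
    proof -
      have "of_real t *\<^sub>C (s *\<^sub>R R x) = s *\<^sub>R (of_real t *\<^sub>C R x)"
        by (simp add: scaleR_scaleC scaleC_scaleC mult.commute)
      then show ?thesis
        using R(3)[of x] by (simp add: S blinfun.scaleR_left blinfun.scaleR_right scaleR_diff_right)
    qed
    ultimately show False
      using t by (auto simp: op_spectrum_def)
  qed
  have form: "0 \<le> Re (cinner (A x) x)" for x
    using A by (auto simp: positive_op_def complex_nonneg_Reals_iff)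
  have form': "Re (cinner (A x) x) \<le> norm A * (norm x)\<^sup>2" for x
  proof -
    have "Re (cinner (A x) x) \<le> norm (A x) * norm x"
      by (rule Re_cinner_le)
    also have "\<dots> \<le> norm A * norm x * norm x"
      by (intro mult_right_mono norm_blinfun) auto
    finally show ?thesis by (simp add: power2_eq_square mult.assoc)
  qed
  have "\<not> 0 < - t"
  proof
    assume "0 < - t"
    then show False
      using form by (intro notcoer[of 1 "-t"]) auto
  qed
  moreover have "\<not> 0 < t - norm A"
  proof
    assume "0 < t - norm A"
    then show False
      using form' by (intro notcoer[of "-1" "t - norm A"]) (auto simp: algebra_simps)
  qed
  ultimately show ?thesis by simp
qed

section \<open>Polynomials of an operator\<close>

lemma op_poly_upto:
  assumes "degree p \<le> n"
  shows "op_poly p A = (\<Sum>i\<le>n. coeff p i *\<^sub>R (((o\<^sub>L) A ^^ i) id_blinfun))"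
  unfolding op_poly_def using assms
  by (intro sum.mono_neutral_left) (auto simp: coeff_eq_0)

lemma op_poly_0 [simp]: "op_poly 0 A = 0"
  by (simp add: op_poly_def)

lemma op_poly_add: "op_poly (p + q) A = op_poly p A + op_poly q A"
proof -
  define n where "n = max (degree p) (degree q)"
  have n: "degree p \<le> n" "degree q \<le> n" "degree (p + q) \<le> n"
    by (auto simp: n_def intro: degree_add_le_max)
  show ?thesis
    unfolding n[THEN op_poly_upto] by (simp add: scaleR_add_left sum.distrib)
qed

lemma op_poly_smult: "op_poly (smult c p) A = c *\<^sub>R op_poly p A"
  using op_poly_upto[of "smult c p" "degree p" A] op_poly_upto[of p "degree p" A]
  by (simp add: scaleR_sum_right)

lemma op_poly_diff: "op_poly (p - q) A = op_poly p A - op_poly q A"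
  using op_poly_add[of p "smult (-1) q" A] op_poly_smult[of "-1" q A] by simp

lemma op_poly_pCons: "op_poly (pCons a p) A x = a *\<^sub>R x + A (op_poly p A x)"
proof -
  have "op_poly (pCons a p) A x
      = (\<Sum>i\<le>Suc (degree p). coeff (pCons a p) i *\<^sub>R (((o\<^sub>L) A ^^ i) id_blinfun)) x"
    using op_poly_upto[of "pCons a p" "Suc (degree p)" A] degree_pCons_le[of a p] by simp
  also have "\<dots> = a *\<^sub>R x + A (op_poly p A x)"
    unfolding sum.atMost_Suc_shift
    by (simp add: op_poly_def blinfun.add_left blinfun.scaleR_left blinfun.sum_left
        blinfun.sum_right blinfun.scaleR_right)
  finally show ?thesis .
qed

lemma op_poly_const: "op_poly [:c:] A = c *\<^sub>R id_blinfun"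
  by (rule blinfun_eqI) (simp add: op_poly_pCons blinfun.scaleR_left)

lemma op_poly_mult: "op_poly (p * q) A x = op_poly p A (op_poly q A x)"
  by (induction p)
     (simp_all add: op_poly_add op_poly_smult op_poly_pCons blinfun.bilinear_simps)

lemma selfadjoint_op_poly:
  assumes "selfadjoint A"
  shows "selfadjoint (op_poly p A)"
proof (induction p)
  case 0
  then show ?case by (simp add: selfadjoint_def)
next
  case (pCons a p)
  have comm: "A (op_poly p A y) = op_poly p A (A y)" for y
    using op_poly_mult[of "[:0,1:]" p A y] op_poly_mult[of p "[:0,1:]" A y]
    by (simp add: op_poly_pCons mult.commute)
  show ?case
    using pCons.IH assms
    by (auto simp: selfadjoint_def op_poly_pCons cinner_simps comm)
qed

text \<open>A real polynomial need not split over the reals, so roots are taken from the complex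
  version of the polynomial, evaluated at the operator by Horner's scheme.\<close>

definition op_cpoly :: "complex poly \<Rightarrow> ('a::chilbert_space \<Rightarrow>\<^sub>L 'a) \<Rightarrow> 'a \<Rightarrow> 'a" where
  "op_cpoly q A x = fold_coeffs (\<lambda>a y. a *\<^sub>C x + A y) q 0"

lemma op_cpoly_0 [simp]: "op_cpoly 0 A x = 0"
  by (simp add: op_cpoly_def)

lemma op_cpoly_pCons [simp]: "op_cpoly (pCons a q) A x = a *\<^sub>C x + A (op_cpoly q A x)"
  by (cases "q = 0 \<and> a = 0") (auto simp: op_cpoly_def)

lemma op_cpoly_of_real: "op_cpoly (map_poly of_real p) A x = op_poly p A x"
  by (induction p) (simp_all add: map_poly_pCons op_poly_pCons scaleR_scaleC)

lemma op_cpoly_mult_linear: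
  assumes "A \<in> bounded_operators"
  shows "op_cpoly ([:- \<mu>, 1:] * q) A x = A (op_cpoly q A x) - \<mu> *\<^sub>C op_cpoly q A x"
proof -
  have lin: "A (c *\<^sub>C y) = c *\<^sub>C A y" for c y
    using assms by (auto simp: bounded_operators_def)
  have add: "op_cpoly (p + q) A x = op_cpoly p A x + op_cpoly q A x" for p q
  proof (induction p arbitrary: q)
    case (pCons a p)
    then show ?case
      by (cases q) (simp add: scaleC_add_left blinfun.add_right)
  qed simp
  have smult: "op_cpoly (smult c q) A x = c *\<^sub>C op_cpoly q A x" for c q
    by (induction q) (simp_all add: scaleC_add_right scaleC_scaleC lin)
  show ?thesis
    using add[of "smult (-\<mu>) q" "pCons 0 q"] smult[of "-\<mu>" q]
    by (simp add: scaleC_minus_left)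
qed

section \<open>Approximate eigenvalues and spectral positivity\<close>

text \<open>The strict inequality excludes \<open>x = 0\<close>, in place of a normalization of \<open>x\<close>.\<close>

definition approx_eigenvalue :: "('a::chilbert_space \<Rightarrow>\<^sub>L 'a) \<Rightarrow> complex \<Rightarrow> bool" where
  "approx_eigenvalue A z \<longleftrightarrow> (\<forall>\<epsilon>>0. \<exists>x. norm (A x - z *\<^sub>C x) < \<epsilon> * norm x)"

lemma approx_eigenvalue_in_spectrum:
  fixes A :: "'a::chilbert_space \<Rightarrow>\<^sub>L 'a"
  assumes "approx_eigenvalue A z"
  shows "z \<in> op_spectrum A"
proof (rule ccontr)
  assume "z \<notin> op_spectrum A"
  then obtain R :: "'a \<Rightarrow>\<^sub>L 'a" where R: "\<And>x. R (A x - z *\<^sub>C x) = x"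
    by (auto simp: op_spectrum_def)
  have "1 / (norm R + 1) > 0"
    by (simp add: add_nonneg_pos)
  then obtain x where x: "norm (A x - z *\<^sub>C x) < 1 / (norm R + 1) * norm x"
    using assms unfolding approx_eigenvalue_def by blast
  have "norm x \<le> norm R * norm (A x - z *\<^sub>C x)"
    using norm_blinfun[of R "A x - z *\<^sub>C x"] by (simp add: R)
  also have "\<dots> \<le> (norm R + 1) * norm (A x - z *\<^sub>C x)"
    by (intro mult_right_mono) auto
  also have "\<dots> < norm x"
  proof -
    have "norm R + 1 > 0" by (simp add: add_nonneg_pos)
    then show ?thesis using x by (metis divide_inverse_commute inverse_eq_divide
          mult.commute pos_less_divide_eq)
  qed
  finally show False by simp
qed

lemma approx_eigenvalue_selfadjoint_real:
  assumes "selfadjoint A" "approx_eigenvalue A z"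
  shows "Im z = 0"
proof (rule ccontr)
  assume "Im z \<noteq> 0"
  then obtain x where x: "norm (A x - z *\<^sub>C x) < \<bar>Im z\<bar> * norm x"
    using assms(2) unfolding approx_eigenvalue_def by (meson zero_less_abs_iff)
  then have x0: "x \<noteq> 0" by auto
  have "Im (cinner (A x - z *\<^sub>C x) x) = - Im z * (norm x)\<^sup>2"
    using Im_cinner_selfadjoint[OF assms(1)] by (simp add: cinner_simps cinner_self del: of_real_power)
  then have "\<bar>Im z\<bar> * (norm x)\<^sup>2 \<le> cmod (cinner (A x - z *\<^sub>C x) x)"
    using abs_Im_le_cmod[of "cinner (A x - z *\<^sub>C x) x"] by (simp add: abs_mult)
  also have "\<dots> \<le> norm (A x - z *\<^sub>C x) * norm x"
    by (rule Cauchy_Schwarz_cinner)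
  also have "\<dots> < \<bar>Im z\<bar> * norm x * norm x"
    using x x0 by (intro mult_strict_right_mono) auto
  finally show False by (simp add: power2_eq_square)
qed

text \<open>Split \<open>q(A)\<close> into linear factors \<open>A - \<mu>\<close>: if all of them were bounded below, so would be their product.\<close>

lemma op_cpoly_not_bounded_below:
  assumes A: "A \<in> bounded_operators" and "q \<noteq> 0"
    and "\<And>\<epsilon>. 0 < \<epsilon> \<Longrightarrow> \<exists>x. norm (op_cpoly q A x) < \<epsilon> * norm x"
  shows "\<exists>\<mu>. poly q \<mu> = 0 \<and> approx_eigenvalue A \<mu>"
  using assms(2,3)
proof (induction "degree q" arbitrary: q)
  case 0
  then obtain c where c: "q = [:c:]" "c \<noteq> 0"
    by (metis degree_eq_zeroE pCons_0_0)
  then obtain x where "norm (op_cpoly q A x) < cmod c * norm x"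
    using 0(3)[of "cmod c"] by auto
  then show ?case
    by (simp add: c norm_scaleC)
next
  case (Suc n)
  have "\<not> constant (poly q)"
    using Suc.hyps(2) by (simp add: constant_degree)
  then obtain \<mu> where \<mu>: "poly q \<mu> = 0"
    using fundamental_theorem_of_algebra by blast
  then obtain q' where q: "q = [:- \<mu>, 1:] * q'"
    unfolding poly_eq_0_iff_dvd by blast
  show ?case
  proof (cases "approx_eigenvalue A \<mu>")
    case True
    then show ?thesis using \<mu> by blast
  next
    case False
    then obtain d where d: "d > 0" "\<And>x. d * norm x \<le> norm (A x - \<mu> *\<^sub>C x)"
      by (auto simp: approx_eigenvalue_def not_less)
    have "q' \<noteq> 0" using Suc.prems(1) q by auto
    moreover have "n = degree q'"
      using Suc.hyps(2) \<open>q' \<noteq> 0\<close> unfolding q by (subst (asm) degree_mult_eq) auto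
    moreover have "\<exists>x. norm (op_cpoly q' A x) < \<epsilon> * norm x" if "\<epsilon> > 0" for \<epsilon>
    proof -
      obtain x where "norm (op_cpoly q A x) < (d * \<epsilon>) * norm x"
        using Suc.prems(2)[of "d * \<epsilon>"] d \<open>\<epsilon> > 0\<close> by auto
      then have "d * norm (op_cpoly q' A x) < d * (\<epsilon> * norm x)"
        using d(2)[of "op_cpoly q' A x"] unfolding q op_cpoly_mult_linear[OF A]
        by (simp add: mult.assoc)
      then show ?thesis using d(1) by auto
    qed
    ultimately obtain \<nu> where "poly q' \<nu> = 0" "approx_eigenvalue A \<nu>"
      using Suc.hyps(1) by blast
    then show ?thesis by (auto simp: q)
  qed
qed

text \<open>Here \<open>m\<close> is the largest lower bound of the form of \<open>T\<close> on unit vectors. The form of the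
  positive operator \<open>T - m\<close> comes arbitrarily close to zero on unit vectors, hence so does the
  norm of \<open>T y - m y\<close>, by \<open>norm_sq_le_form\<close>.\<close>

lemma form_bottom_approx_eigenvalue:
  fixes T :: "'a::chilbert_space \<Rightarrow>\<^sub>L 'a" and x :: 'a
  assumes sa: "selfadjoint T" and x0: "x \<noteq> 0"
  obtains m where "\<And>y. m * (norm y)\<^sup>2 \<le> Re (cinner (T y) y)"
    "approx_eigenvalue T (complex_of_real m)"
proof -
  define \<phi> where "\<phi> x = Re (cinner (T x) x)" for x
  define lower where "lower = {m. \<forall>y. m * (norm y)\<^sup>2 \<le> \<phi> y}"
  define m where "m = Sup lower"
  have "- norm T \<in> lower"
  proof -
    have "- norm T * (norm y)\<^sup>2 \<le> \<phi> y" for y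
    proof -
      have "- \<phi> y \<le> norm (T y) * norm y"
        using Re_cinner_le[of "- T y" y] by (simp add: \<phi>_def cinner_simps)
      also have "\<dots> \<le> norm T * norm y * norm y"
        by (intro mult_right_mono norm_blinfun) auto
      finally show ?thesis by (simp add: power2_eq_square mult.assoc)
    qed
    then show ?thesis by (simp add: lower_def)
  qed
  then have ne: "lower \<noteq> {}" by auto
  have upper: "c \<le> \<phi> y / (norm y)\<^sup>2" if "c \<in> lower" "y \<noteq> 0" for c y
    using that by (simp add: lower_def field_simps)
  have bdd: "bdd_above lower"
    by (rule bdd_aboveI[where M = "\<phi> x / (norm x)\<^sup>2"]) (use upper x0 in auto)
  have m_low: "m * (norm y)\<^sup>2 \<le> \<phi> y" for y
  proof (cases "y = 0")
    case False
    then have "m \<le> \<phi> y / (norm y)\<^sup>2"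
      unfolding m_def using ne upper by (intro cSup_least) auto
    then show ?thesis using False by (simp add: field_simps)
  qed (simp add: \<phi>_def)
  define S where "S = T - m *\<^sub>R id_blinfun"
  have S: "S y = T y - m *\<^sub>R y" for y
    by (simp add: S_def blinfun.diff_left blinfun.scaleR_left)
  have form: "Re (cinner (S y) y) = \<phi> y - m * (norm y)\<^sup>2" for y
    by (simp add: S cinner_simps cinner_self \<phi>_def)
  have S_sa: "selfadjoint S"
    using sa by (simp add: selfadjoint_def S cinner_simps)
  define K where "K = norm S + 1"
  have K: "norm S \<le> K" "0 < K" by (auto simp: K_def add_nonneg_pos)
  have S_small: "(norm (S y))\<^sup>2 \<le> K * (\<phi> y - m * (norm y)\<^sup>2)" for y
    unfolding form[symmetric] by (rule norm_sq_le_form[OF S_sa _ K]) (simp add: form m_low)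
  have "\<exists>y. norm (T y - complex_of_real m *\<^sub>C y) < \<epsilon> * norm y" if "\<epsilon> > 0" for \<epsilon>
  proof -
    have "m + \<epsilon>\<^sup>2 / K \<notin> lower"
      using cSup_upper[OF _ bdd, of "m + \<epsilon>\<^sup>2 / K"] that K
      by (auto simp: m_def[symmetric] divide_le_0_iff)
    then obtain y where "\<phi> y < (m + \<epsilon>\<^sup>2 / K) * (norm y)\<^sup>2"
      by (auto simp: lower_def not_le)
    then have "K * (\<phi> y - m * (norm y)\<^sup>2) < (\<epsilon> * norm y)\<^sup>2"
      using K by (simp add: field_simps)
    then have "(norm (S y))\<^sup>2 < (\<epsilon> * norm y)\<^sup>2"
      using S_small[of y] by linarith
    then have "norm (S y) < \<epsilon> * norm y"
      by (rule power2_less_imp_less) (use that in auto)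
    then have "norm (T y - complex_of_real m *\<^sub>C y) < \<epsilon> * norm y"
      by (simp only: S scaleR_scaleC)
    then show ?thesis ..
  qed
  then have "approx_eigenvalue T (complex_of_real m)"
    unfolding approx_eigenvalue_def by blast
  then show ?thesis
    using that m_low unfolding \<phi>_def by blast
qed

text \<open>The nontrivial half of spectral mapping, by the roots of \<open>p - m\<close>. These are real because
  \<open>A\<close> is self-adjoint.\<close>

lemma approx_eigenvalue_op_poly:
  fixes A :: "'a::chilbert_space \<Rightarrow>\<^sub>L 'a"
  assumes A: "A \<in> bounded_operators" "selfadjoint A"
    and m: "approx_eigenvalue (op_poly p A) (complex_of_real m)"
  obtains t where "approx_eigenvalue A (complex_of_real t)" "poly p t = m"
proof (cases "p = [:m:]")
  case True
  \<comment> \<open>Every approximate eigenvalue will do. One exists since the space is not trivial.\<close>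
  obtain x where "norm (op_poly p A x - complex_of_real m *\<^sub>C x) < 1 * norm x"
    using m unfolding approx_eigenvalue_def by (meson zero_less_one)
  then have "x \<noteq> 0" by auto
  then obtain t where "approx_eigenvalue A (complex_of_real t)"
    using form_bottom_approx_eigenvalue[OF A(2)] by metis
  then show ?thesis
    using that[of t] True by simp
next
  case False
  have poly_of_real: "poly (map_poly of_real q) (of_real x) = complex_of_real (poly q x)" for q x
    by (induction q) (auto simp: map_poly_pCons)
  have "op_poly (p - [:m:]) A x = op_poly p A x - complex_of_real m *\<^sub>C x" for x
    by (simp add: op_poly_diff op_poly_const blinfun.diff_left blinfun.scaleR_left scaleR_scaleC)
  then have "\<exists>x. norm (op_cpoly (map_poly of_real (p - [:m:])) A x) < \<epsilon> * norm x"
    if "\<epsilon> > 0" for \<epsilon>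
    using m that by (simp add: op_cpoly_of_real approx_eigenvalue_def)
  moreover have "map_poly complex_of_real (p - [:m:]) \<noteq> 0"
    using False by (simp add: map_poly_eq_0_iff)
  ultimately obtain \<mu> where \<mu>: "poly (map_poly of_real (p - [:m:])) \<mu> = 0" "approx_eigenvalue A \<mu>"
    using op_cpoly_not_bounded_below[OF A(1)] by blast
  obtain t where t: "\<mu> = of_real t"
    using approx_eigenvalue_selfadjoint_real[OF A(2) \<mu>(2)]
    by (metis complex_is_Real_iff Reals_cases)
  have "poly (p - [:m:]) t = 0"
    using \<mu>(1) unfolding t by (simp only: poly_of_real of_real_eq_0_iff)
  then show ?thesis
    using that[of t] \<mu>(2) t by simp
qed

lemma op_poly_nonneg:
  fixes A :: "'a::chilbert_space \<Rightarrow>\<^sub>L 'a"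
  assumes A: "positive_op A"
    and p: "\<And>t. complex_of_real t \<in> op_spectrum A \<Longrightarrow> 0 \<le> poly p t"
  shows "0 \<le> Re (cinner (op_poly p A x) x)"
proof (cases "x = 0")
  case False
  have sa: "selfadjoint A" and lin: "A \<in> bounded_operators"
    using A positive_op_selfadjoint by (auto simp: positive_op_def)
  obtain m where m: "\<And>y. m * (norm y)\<^sup>2 \<le> Re (cinner (op_poly p A y) y)"
      "approx_eigenvalue (op_poly p A) (complex_of_real m)"
    using form_bottom_approx_eigenvalue[OF selfadjoint_op_poly[OF sa] False] by metis
  obtain t where "approx_eigenvalue A (complex_of_real t)" "poly p t = m"
    using approx_eigenvalue_op_poly[OF lin sa m(2)] by metis
  then have "0 \<le> m"
    using p approx_eigenvalue_in_spectrum by blast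
  then have "0 \<le> m * (norm x)\<^sup>2" by simp
  then show ?thesis using m(1)[of x] by linarith
qed simp

text \<open>The polynomial \<open>c\<^sup>2 - p\<^sup>2\<close> is nonnegative on the spectrum. As \<open>p(A)\<close> is self-adjoint, the form
  of its value at \<open>A\<close> is \<open>c\<^sup>2 \<parallel>x\<parallel>\<^sup>2 - \<parallel>p(A) x\<parallel>\<^sup>2\<close>.\<close>

lemma norm_op_poly_le:
  fixes A :: "'a::chilbert_space \<Rightarrow>\<^sub>L 'a"
  assumes A: "positive_op A" and "0 \<le> c"
    and p: "\<And>t. complex_of_real t \<in> op_spectrum A \<Longrightarrow> \<bar>poly p t\<bar> \<le> c"
  shows "norm (op_poly p A) \<le> c"
proof (rule norm_blinfun_bound[OF \<open>0 \<le> c\<close>])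
  fix x
  have sa: "selfadjoint (op_poly p A)"
    using A by (intro selfadjoint_op_poly positive_op_selfadjoint)
  have "0 \<le> Re (cinner (op_poly ([:c\<^sup>2:] - p * p) A x) x)"
  proof (rule op_poly_nonneg[OF A])
    fix t assume "complex_of_real t \<in> op_spectrum A"
    then have "\<bar>poly p t\<bar>\<^sup>2 \<le> c\<^sup>2" using p by (intro power_mono) auto
    then show "0 \<le> poly ([:c\<^sup>2:] - p * p) t" by (simp add: power2_eq_square)
  qed
  also have "\<dots> = c\<^sup>2 * (norm x)\<^sup>2 - (norm (op_poly p A x))\<^sup>2"
    using sa by (simp add: op_poly_diff op_poly_const op_poly_mult blinfun.diff_left
        blinfun.scaleR_left cinner_simps cinner_self selfadjoint_def)
  finally have "(norm (op_poly p A x))\<^sup>2 \<le> (c * norm x)\<^sup>2"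
    by (simp add: power_mult_distrib)
  then show "norm (op_poly p A x) \<le> c * norm x"
    by (rule power2_le_imp_le) (use \<open>0 \<le> c\<close> in auto)
qed

section \<open>Continuous functional calculus\<close>

text \<open>The norm bound makes the polynomials of \<open>A\<close> a Cauchy sequence and their limit independent of
  the approximating polynomials.\<close>

lemma cfc_limit:
  fixes A :: "'a::chilbert_space \<Rightarrow>\<^sub>L 'a"
  assumes A: "positive_op A"
    and p: "uniform_limit {t. complex_of_real t \<in> op_spectrum A} (\<lambda>n. poly (p n)) f sequentially"
  shows "(\<lambda>n. op_poly (p n) A) \<longlonglongrightarrow> cfc f A"
proof -
  let ?spec = "{t. complex_of_real t \<in> op_spectrum A}"
  have close: "norm (op_poly a A - op_poly b A) \<le> \<epsilon> + \<delta>"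
    if "\<forall>t\<in>?spec. dist (poly a t) (f t) < \<epsilon>" "\<forall>t\<in>?spec. dist (poly b t) (f t) < \<delta>"
      "\<epsilon> > 0" "\<delta> > 0" for a b \<epsilon> \<delta>
    unfolding op_poly_diff[symmetric]
  proof (rule norm_op_poly_le[OF A])
    fix t assume "complex_of_real t \<in> op_spectrum A"
    then show "\<bar>poly (a - b) t\<bar> \<le> \<epsilon> + \<delta>"
      using that(1)[rule_format, of t] that(2)[rule_format, of t] by (simp add: dist_real_def)
  qed (use that in auto)
  have "Cauchy (\<lambda>n. op_poly (p n) A)"
  proof (rule CauchyI)
    fix e :: real assume "0 < e"
    obtain N where N: "\<And>n. n \<ge> N \<Longrightarrow> \<forall>t\<in>?spec. dist (poly (p n) t) (f t) < e / 3"
      using uniform_limitD[OF p, of "e / 3"] \<open>0 < e\<close> unfolding eventually_sequentially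
      by (meson divide_pos_pos zero_less_numeral)
    have "norm (op_poly (p m) A - op_poly (p n) A) < e" if "m \<ge> N" "n \<ge> N" for m n
      using close[OF N[OF that(1)] N[OF that(2)]] \<open>0 < e\<close> by simp
    then show "\<exists>M. \<forall>m\<ge>M. \<forall>n\<ge>M. norm (op_poly (p m) A - op_poly (p n) A) < e"
      by blast
  qed
  then obtain T where T: "(\<lambda>n. op_poly (p n) A) \<longlonglongrightarrow> T"
    using Cauchy_convergent_iff convergent_def by blast
  have "T' = T"
    if q: "uniform_limit ?spec (\<lambda>n. poly (q n)) f sequentially"
      and T': "(\<lambda>n. op_poly (q n) A) \<longlonglongrightarrow> T'" for q T'
  proof -
    have "(\<lambda>n. op_poly (q n) A - op_poly (p n) A) \<longlonglongrightarrow> 0"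
    proof (rule tendstoI)
      fix e :: real assume "0 < e"
      then have "\<forall>\<^sub>F n in sequentially. \<forall>t\<in>?spec. dist (poly (q n) t) (f t) < e / 3"
        "\<forall>\<^sub>F n in sequentially. \<forall>t\<in>?spec. dist (poly (p n) t) (f t) < e / 3"
        using uniform_limitD[OF p, of "e / 3"] uniform_limitD[OF q, of "e / 3"] by auto
      then show "\<forall>\<^sub>F n in sequentially. dist (op_poly (q n) A - op_poly (p n) A) 0 < e"
      proof eventually_elim
        case (elim n)
        show ?case
          using close[OF elim] \<open>0 < e\<close> by (simp add: dist_norm)
      qed
    qed
    then have "T' - T = 0"
      using tendsto_diff[OF T' T] LIMSEQ_unique by blast
    then show ?thesis by simp
  qed
  then have "cfc f A = T"
    unfolding cfc_def using p T by (intro the_equality) blast+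
  then show ?thesis using T by simp
qed

text \<open>By \<open>positive_op_real_spectrum\<close>, Weierstrass approximation on \<open>[0, \<parallel>A\<parallel>]\<close> suffices.\<close>

lemma cfc_approximation:
  fixes A :: "'a::chilbert_space \<Rightarrow>\<^sub>L 'a"
  assumes A: "positive_op A" and f: "continuous_on {0..norm A} f"
  obtains p where "uniform_limit {t. complex_of_real t \<in> op_spectrum A} (\<lambda>n. poly (p n)) f sequentially"
    "(\<lambda>n. op_poly (p n) A) \<longlonglongrightarrow> cfc f A"
proof -
  have ex: "\<exists>q. \<forall>t\<in>{0..norm A}. \<bar>f t - poly q t\<bar> < e" if "e > 0" for e
  proof -
    obtain g where g: "real_polynomial_function g" "\<And>t. t \<in> {0..norm A} \<Longrightarrow> \<bar>f t - g t\<bar> < e"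
      using Stone_Weierstrass_real_polynomial_function[OF compact_Icc f \<open>e > 0\<close>] by metis
    obtain a n where "g = (\<lambda>x. \<Sum>i\<le>n. a i * x ^ i)"
      using g(1) unfolding real_polynomial_function_iff_sum by blast
    then have "poly (\<Sum>i\<le>n. monom (a i) i) t = g t" for t
      by (simp add: poly_sum poly_monom)
    then show ?thesis using g(2) by metis
  qed
  have "\<forall>n. \<exists>q. \<forall>t\<in>{0..norm A}. \<bar>f t - poly q t\<bar> < inverse (real (Suc n))"
    using ex by simp
  then obtain p where p: "\<And>n t. t \<in> {0..norm A} \<Longrightarrow> \<bar>f t - poly (p n) t\<bar> < inverse (real (Suc n))"
    by metis
  have "uniform_limit {t. complex_of_real t \<in> op_spectrum A} (\<lambda>n. poly (p n)) f sequentially"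
  proof (rule uniform_limitI)
    fix e :: real assume "0 < e"
    then have "\<forall>\<^sub>F n in sequentially. inverse (real (Suc n)) < e"
      using LIMSEQ_inverse_real_of_nat by (rule order_tendstoD(2)[rotated])
    then show "\<forall>\<^sub>F n in sequentially. \<forall>t\<in>{t. complex_of_real t \<in> op_spectrum A}.
        dist (poly (p n) t) (f t) < e"
    proof eventually_elim
      case (elim n)
      show ?case
        using p[of _ n] positive_op_real_spectrum[OF A] elim
        by (force simp: dist_real_def abs_minus_commute)
    qed
  qed
  then show ?thesis using that cfc_limit[OF A] by blast
qed

lemma bounded_bilinear_cinner:
  "bounded_bilinear (cinner :: 'a::chilbert_space \<Rightarrow> 'a \<Rightarrow> complex)"
proof
  show "\<exists>K. \<forall>x y::'a. cmod (cinner x y) \<le> norm x * norm y * K"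
    using Cauchy_Schwarz_cinner by (auto intro!: exI[of _ 1])
qed (simp_all add: cinner_simps scaleR_conv_of_real)

lemmas tendsto_cinner = bounded_bilinear.tendsto[OF bounded_bilinear_cinner]

lemma selfadjoint_cfc:
  assumes A: "positive_op A" and f: "continuous_on {0..norm A} f"
  shows "selfadjoint (cfc f A)"
  unfolding selfadjoint_def
proof (intro allI)
  fix x y
  obtain p where p: "(\<lambda>n. op_poly (p n) A) \<longlonglongrightarrow> cfc f A"
    using cfc_approximation[OF A f] by metis
  have lim: "(\<lambda>n. op_poly (p n) A z) \<longlonglongrightarrow> cfc f A z" for z
    by (intro blinfun.tendsto p tendsto_const)
  have "cinner (op_poly (p n) A x) y = cinner x (op_poly (p n) A y)" for n
    using selfadjoint_op_poly[OF positive_op_selfadjoint[OF A]] by (simp add: selfadjoint_def)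
  then have "(\<lambda>n. cinner (op_poly (p n) A x) y) \<longlonglongrightarrow> cinner x (cfc f A y)"
    by (simp add: tendsto_cinner lim)
  moreover have "(\<lambda>n. cinner (op_poly (p n) A x) y) \<longlonglongrightarrow> cinner (cfc f A x) y"
    by (intro tendsto_cinner lim tendsto_const)
  ultimately show "cinner (cfc f A x) y = cinner x (cfc f A y)"
    by (rule LIMSEQ_unique[rotated])
qed

text \<open>For approximating polynomials \<open>p\<close> of \<open>f\<close> and \<open>q\<close> of \<open>g\<close>, the polynomial \<open>a q + b - c p\<^sup>2\<close> is
  nonnegative on the spectrum up to a small error, hence so is the form of its value at \<open>A\<close>.
  Since \<open>p(A)\<close> is self-adjoint, the square contributes \<open>\<parallel>p(A) x\<parallel>\<^sup>2\<close>.\<close>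

lemma cfc_form_inequality:
  fixes A :: "'a::chilbert_space \<Rightarrow>\<^sub>L 'a"
  assumes A: "positive_op A"
    and f: "continuous_on {0..norm A} f" and g: "continuous_on {0..norm A} g"
    and le: "\<And>t. 0 \<le> t \<Longrightarrow> t \<le> norm A \<Longrightarrow> c * (f t)\<^sup>2 \<le> a * g t + b"
  shows "c * (norm (cfc f A x))\<^sup>2 \<le> a * Re (cinner (cfc g A x) x) + b * (norm x)\<^sup>2"
proof -
  let ?spec = "{t. complex_of_real t \<in> op_spectrum A}"
  have spec: "?spec \<subseteq> {0..norm A}"
    using positive_op_real_spectrum[OF A] by auto
  have bdd: "bounded (h ` ?spec)" if "continuous_on {0..norm A} h" for h :: "real \<Rightarrow> real"
    using compact_imp_bounded[OF compact_continuous_image[OF that compact_Icc]] spec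
    by (meson bounded_subset image_mono)
  obtain p where p: "uniform_limit ?spec (\<lambda>n. poly (p n)) f sequentially"
      "(\<lambda>n. op_poly (p n) A) \<longlonglongrightarrow> cfc f A"
    using cfc_approximation[OF A f] by metis
  obtain q where q: "uniform_limit ?spec (\<lambda>n. poly (q n)) g sequentially"
      "(\<lambda>n. op_poly (q n) A) \<longlonglongrightarrow> cfc g A"
    using cfc_approximation[OF A g] by metis
  define R where "R n = smult a (q n) + [:b:] - smult c (p n * p n)" for n
  have "uniform_limit ?spec (\<lambda>n t. a * poly (q n) t + b - c * (poly (p n) t * poly (p n) t))
      (\<lambda>t. a * g t + b - c * (f t * f t)) sequentially"
    by (intro uniform_limit_intros p(1) q(1) uniform_lim_mult bdd f
        bounded_linear.uniform_limit[OF bounded_linear_mult_right])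
  moreover have "poly (R n) = (\<lambda>t. a * poly (q n) t + b - c * (poly (p n) t * poly (p n) t))" for n
    by (auto simp: R_def)
  ultimately have R_lim:
    "uniform_limit ?spec (\<lambda>n. poly (R n)) (\<lambda>t. a * g t + b - c * (f t)\<^sup>2) sequentially"
    by (simp add: power2_eq_square)
  have sa: "selfadjoint (op_poly (p n) A)" for n
    using A by (intro selfadjoint_op_poly positive_op_selfadjoint)
  have R_form: "Re (cinner (op_poly (R n) A x) x) = a * Re (cinner (op_poly (q n) A x) x)
      + b * (norm x)\<^sup>2 - c * (norm (op_poly (p n) A x))\<^sup>2" for n
    using sa[of n] by (simp add: R_def op_poly_diff op_poly_add op_poly_smult op_poly_const
        op_poly_mult blinfun.bilinear_simps cinner_simps cinner_self selfadjoint_def)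
  define V where "V = a * Re (cinner (cfc g A x) x) + b * (norm x)\<^sup>2 - c * (norm (cfc f A x))\<^sup>2"
  have V: "(\<lambda>n. Re (cinner (op_poly (R n) A x) x)) \<longlonglongrightarrow> V"
    unfolding R_form V_def
    by (intro tendsto_intros tendsto_cinner blinfun.tendsto p q)
  have "0 \<le> V"
  proof (rule field_le_epsilon)
    fix e :: real assume "0 < e"
    define \<epsilon> where "\<epsilon> = e / ((norm x)\<^sup>2 + 1)"
    have \<epsilon>: "\<epsilon> > 0" "\<epsilon> * (norm x)\<^sup>2 \<le> e"
      using \<open>0 < e\<close> add_nonneg_pos[OF zero_le_power2 zero_less_one, of "norm x"]
      by (simp_all add: \<epsilon>_def field_simps)
    have "\<forall>\<^sub>F n in sequentially. - e \<le> Re (cinner (op_poly (R n) A x) x)"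
      using uniform_limitD[OF R_lim \<epsilon>(1)]
    proof eventually_elim
      case (elim n)
      have "0 \<le> Re (cinner (op_poly (R n + [:\<epsilon>:]) A x) x)"
      proof (rule op_poly_nonneg[OF A])
        fix t assume t: "complex_of_real t \<in> op_spectrum A"
        then have "0 \<le> a * g t + b - c * (f t)\<^sup>2"
          using le[of t] spec by auto
        then show "0 \<le> poly (R n + [:\<epsilon>:]) t"
          using elim t by (force simp: dist_real_def)
      qed
      also have "\<dots> = Re (cinner (op_poly (R n) A x) x) + \<epsilon> * (norm x)\<^sup>2"
        by (simp add: op_poly_add op_poly_const blinfun.bilinear_simps cinner_simps cinner_self)
      finally show ?case using \<epsilon>(2) by linarith
    qed
    then show "0 \<le> V + e"
      using tendsto_lowerbound[OF V] by force
  qed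
  then show ?thesis by (simp add: V_def)
qed

section \<open>Powers of positive operators\<close>

lemma continuous_on_powr_nonneg:
  assumes "0 \<le> (s::real)"
  shows "continuous_on {0..M} (\<lambda>t. if s = 0 then 1 else t powr s)"
proof (cases "s = 0")
  case False
  then show ?thesis
    using assms by (auto intro!: continuous_on_powr' continuous_on_id continuous_on_const)
qed simp

lemma selfadjoint_op_powr:
  "positive_op A \<Longrightarrow> 0 \<le> s \<Longrightarrow> selfadjoint (op_powr A s)"
  unfolding op_powr_def by (intro selfadjoint_cfc continuous_on_powr_nonneg)

lemma op_powr_form_nonneg:
  assumes "positive_op A" "0 \<le> s"
  shows "0 \<le> Re (cinner (op_powr A s x) x)"
  using cfc_form_inequality[OF assms(1) continuous_on_powr_nonneg continuous_on_powr_nonneg,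
      of s s 0 1 0 x] assms(2)
  by (simp add: op_powr_def)

text \<open>The Hoelder-McCarthy inequality \<open>\<parallel>A\<^sup>\<alpha> x\<parallel>\<^sup>2 \<le> \<langle>A\<^sup>r x, x\<rangle>\<^bsup>2\<alpha>/r\<^esup>\<close>. With \<open>\<theta> = 2 \<alpha> / r\<close>, Young's
  inequality bounds \<open>t\<^bsup>2\<alpha>\<^esup>\<close> by the affine function \<open>s\<^bsup>\<theta>-1\<^esup> (\<theta> t\<^sup>r + (1 - \<theta>) s)\<close> of \<open>t\<^sup>r\<close>, so the form
  of \<open>A\<^bsup>2\<alpha>\<^esup>\<close> at \<open>x\<close> is bounded by the same affine function of the form of \<open>A\<^sup>r\<close>. The best
  choice of \<open>s\<close> is the latter form itself; other positive upper bounds are admitted because this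
  form may vanish.\<close>

lemma norm_op_powr_le:
  fixes A :: "'a::chilbert_space \<Rightarrow>\<^sub>L 'a"
  assumes A: "positive_op A" and \<alpha>: "0 \<le> \<alpha>" "2 * \<alpha> \<le> r" and r: "0 < r"
    and x: "norm x = 1" and s: "0 < s" "Re (cinner (op_powr A r x) x) \<le> s"
  shows "norm (op_powr A \<alpha> x) powr r \<le> s powr \<alpha>"
proof -
  define \<theta> where "\<theta> = 2 * \<alpha> / r"
  have \<theta>: "0 \<le> \<theta>" "\<theta> \<le> 1" using \<alpha> r by (auto simp: \<theta>_def field_simps)
  have young: "s powr (1 - \<theta>) * (if \<alpha> = 0 then 1 else t powr \<alpha>)\<^sup>2
      \<le> \<theta> * (if r = 0 then 1 else t powr r) + (1 - \<theta>) * s" if "0 \<le> t" for t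
  proof -
    consider "\<alpha> = 0" | "\<alpha> \<noteq> 0" "t = 0" | "\<alpha> \<noteq> 0" "0 < t"
      using \<open>0 \<le> t\<close> by (auto simp: order_le_less)
    then show ?thesis
    proof cases
      case 1
      then show ?thesis using s by (simp add: \<theta>_def)
    next
      case 2
      then show ?thesis using s \<theta> r by simp
    next
      case 3
      have "(t powr \<alpha>)\<^sup>2 = (t powr r) powr \<theta>"
        using r 3 by (simp add: \<theta>_def powr_powr power2_eq_square powr_add[symmetric])
      then show ?thesis
        using Youngs_inequality_0[of \<theta> "1 - \<theta>" "t powr r" s] \<theta> 3 s r by (simp add: mult.commute)
    qed
  qed
  have "s powr (1 - \<theta>) * (norm (op_powr A \<alpha> x))\<^sup>2
      \<le> \<theta> * Re (cinner (op_powr A r x) x) + ((1 - \<theta>) * s) * (norm x)\<^sup>2"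
    unfolding op_powr_def
    by (intro cfc_form_inequality A continuous_on_powr_nonneg young) (use \<alpha> r in auto)
  also have "\<dots> \<le> \<theta> * s + (1 - \<theta>) * s"
    using s(2) \<theta>(1) x by (simp add: mult_left_mono)
  also have "\<dots> = s powr (1 - \<theta>) * s powr \<theta>"
    using s(1) by (simp add: powr_add[symmetric] algebra_simps)
  finally have "(norm (op_powr A \<alpha> x))\<^sup>2 \<le> s powr \<theta>"
    using s(1) by simp
  then have "((norm (op_powr A \<alpha> x))\<^sup>2) powr (r / 2) \<le> (s powr \<theta>) powr (r / 2)"
    using r by (intro powr_mono2) auto
  also have "\<dots> = s powr \<alpha>"
    using r by (simp add: powr_powr \<theta>_def)
  finally have "((norm (op_powr A \<alpha> x))\<^sup>2) powr (r / 2) \<le> s powr \<alpha>" .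
  moreover have "((norm (op_powr A \<alpha> x))\<^sup>2) powr (r / 2) = norm (op_powr A \<alpha> x) powr r"
    by (cases "op_powr A \<alpha> x = 0") (simp_all add: powr_powr flip: powr_numeral)
  ultimately show ?thesis by simp
qed

section \<open>The numerical radius inequality\<close>

text \<open>Adding \<open>e > 0\<close> to the forms of \<open>A\<^sup>r\<close> and \<open>B\<^sup>r\<close> keeps them positive, and it costs only \<open>e\<close> in
  the final bound since the weights \<open>\<alpha>\<close> and \<open>1 - \<alpha>\<close> add up to one.\<close>

lemma cinner_op_powr_le:
  fixes A B X :: "'a::chilbert_space \<Rightarrow>\<^sub>L 'a"
  assumes A: "positive_op A" and B: "positive_op B"
    and r: "r \<ge> 2" and \<alpha>: "0 \<le> \<alpha>" "\<alpha> \<le> 1" and x: "norm x = 1"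
  shows "cmod (cinner ((op_powr A \<alpha> o\<^sub>L X o\<^sub>L op_powr B (1 - \<alpha>)) x) x) powr r
    \<le> norm X powr r * norm (\<alpha> *\<^sub>R op_powr A r + (1 - \<alpha>) *\<^sub>R op_powr B r)"
    (is "?v powr r \<le> _ * norm ?T")
proof -
  define u where "u = norm (op_powr A \<alpha> x)"
  define w where "w = norm (op_powr B (1 - \<alpha>) x)"
  define a where "a = Re (cinner (op_powr A r x) x)"
  define b where "b = Re (cinner (op_powr B r x) x)"
  have ab: "0 \<le> a" "0 \<le> b"
    using r by (auto simp: a_def b_def intro!: op_powr_form_nonneg A B)
  have "?v = cmod (cinner (X (op_powr B (1 - \<alpha>) x)) (op_powr A \<alpha> x))"
    using selfadjoint_op_powr[OF A \<alpha>(1)] by (simp add: selfadjoint_def)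
  also have "\<dots> \<le> norm (X (op_powr B (1 - \<alpha>) x)) * u"
    unfolding u_def by (rule Cauchy_Schwarz_cinner)
  also have "\<dots> \<le> norm X * w * u"
    unfolding w_def by (intro mult_right_mono norm_blinfun) (simp add: u_def)
  finally have "?v powr r \<le> (norm X * w * u) powr r"
    using r by (intro powr_mono2) auto
  also have "\<dots> = norm X powr r * (u powr r * w powr r)"
    by (simp add: powr_mult u_def w_def)
  also have "u powr r * w powr r \<le> norm ?T"
  proof (rule field_le_epsilon)
    fix e :: real assume e: "0 < e"
    have "u powr r \<le> (a + e) powr \<alpha>"
      unfolding u_def using r \<alpha> ab e by (intro norm_op_powr_le[OF A _ _ _ x]) (auto simp: a_def)
    moreover have "w powr r \<le> (b + e) powr (1 - \<alpha>)"
      unfolding w_def using r \<alpha> ab e by (intro norm_op_powr_le[OF B _ _ _ x]) (auto simp: b_def)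
    ultimately have "u powr r * w powr r \<le> (a + e) powr \<alpha> * (b + e) powr (1 - \<alpha>)"
      by (intro mult_mono) auto
    also have "\<dots> \<le> \<alpha> * (a + e) + (1 - \<alpha>) * (b + e)"
      using \<alpha> ab e by (intro Youngs_inequality_0) auto
    also have "\<dots> = Re (cinner (?T x) x) + e"
      by (simp add: a_def b_def blinfun.bilinear_simps cinner_simps algebra_simps)
    also have "\<dots> \<le> norm ?T + e"
      using Re_cinner_le[of "?T x" x] norm_blinfun[of ?T x] x by simp
    finally show "u powr r * w powr r \<le> norm ?T + e" .
  qed
  finally show ?thesis by (simp add: mult_left_mono)
qed

theorem theorem3p3:
  fixes A B X :: "'a::chilbert_space \<Rightarrow>\<^sub>L 'a" and r \<alpha> :: real
  assumes "A \<in> bounded_operators" and "B \<in> bounded_operators" and "X \<in> bounded_operators"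
    and "positive_op A" and "positive_op B"
    and "r \<ge> 2" and "0 \<le> \<alpha>" and "\<alpha> \<le> 1"
  shows "numerical_radius (op_powr A \<alpha> o\<^sub>L X o\<^sub>L op_powr B (1 - \<alpha>)) powr r
    \<le> norm X powr r * norm (\<alpha> *\<^sub>R op_powr A r + (1 - \<alpha>) *\<^sub>R op_powr B r)"
proof -
  let ?S = "op_powr A \<alpha> o\<^sub>L X o\<^sub>L op_powr B (1 - \<alpha>)"
  let ?M = "norm X powr r * norm (\<alpha> *\<^sub>R op_powr A r + (1 - \<alpha>) *\<^sub>R op_powr B r)"
  have "cmod (cinner (?S x) x) \<le> ?M powr (1 / r)" if "norm x = 1" for x
  proof -
    have "(cmod (cinner (?S x) x) powr r) powr (1 / r) \<le> ?M powr (1 / r)"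
      using cinner_op_powr_le[OF assms(4-8) that] assms(6) by (intro powr_mono2) auto
    then show ?thesis using assms(6) by (simp add: powr_powr)
  qed
  then have bound: "v \<le> ?M powr (1 / r)"
    if "v \<in> insert 0 {cmod (cinner (?S x) x) | x. norm x = 1}" for v
    using that by auto
  have "numerical_radius ?S \<le> ?M powr (1 / r)"
    unfolding numerical_radius_def by (rule cSup_least) (use bound in blast)+
  moreover have "0 \<le> numerical_radius ?S"
    unfolding numerical_radius_def
    by (intro cSup_upper bdd_aboveI[where M = "?M powr (1 / r)"] bound) auto
  ultimately have "numerical_radius ?S powr r \<le> (?M powr (1 / r)) powr r"
    using assms(6) by (intro powr_mono2) auto
  also have "\<dots> = ?M"
    using assms(6) by (simp add: powr_powr)
  finally show ?thesis .
qed

end
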